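(* Let $p$ be a prime. There exists a group $P$ of order $p^7$, with $\mathrm{Z}(P)$ and $P/\mathrm{Z}(P)$ both elementary abelian, whose Chermak-Delgado lattice is a chain $\mathrm{Z}(P) < A < P$ of length 2, i.e. $\mathcal{CD}(P) = \{\mathrm{Z}(P), A, P\}$ for some subgroup $A$ with $\mathrm{Z}(P) < A < P$ (proper inclusions).
   Context: For a finite group $G$ and a subgroup $U \le G$, the Chermak-Delgado measure of $U$ in $G$ is $m_G(U) = |U|\,|C_G(U)|$. Put $m(G) = \max\{m_G(U) \mid U \le G\}$ and $\mathcal{CD}(G) = \{U \le G \mid m_G(U) = m(G)\}$, the Chermak-Delgado lattice of $G$. $\mathrm{Z}(P)$ denotes the center of $P$. *)

theory Defs
  imports "HOL-Algebra.Coset" "HOL-Computational_Algebra.Primes"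
begin

definition centralizer :: "('a, 'b) monoid_scheme \<Rightarrow> 'a set \<Rightarrow> 'a set" where
  "centralizer G U =
     {x \<in> carrier G. \<forall>u\<in>U. x \<otimes>\<^bsub>G\<^esub> u = u \<otimes>\<^bsub>G\<^esub> x}"

definition center :: "('a, 'b) monoid_scheme \<Rightarrow> 'a set" where
  "center G = centralizer G (carrier G)"

definition elementary_abelian :: "nat \<Rightarrow> ('a, 'b) monoid_scheme \<Rightarrow> bool" where
  "elementary_abelian p G \<longleftrightarrow>
     comm_group G \<and> (\<forall>x\<in>carrier G. x [^]\<^bsub>G\<^esub> p = \<one>\<^bsub>G\<^esub>)"

definition cd_measure :: "('a, 'b) monoid_scheme \<Rightarrow> 'a set \<Rightarrow> nat" where
  "cd_measure G U = card U * card (centralizer G U)"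

(* The maximum is meaningful only for a finite group G. *)
definition max_cd_measure :: "('a, 'b) monoid_scheme \<Rightarrow> nat" where
  "max_cd_measure G = Max {cd_measure G U | U. subgroup U G}"

definition cd_lattice :: "('a, 'b) monoid_scheme \<Rightarrow> 'a set set" where
  "cd_lattice G = {U. subgroup U G \<and> cd_measure G U = max_cd_measure G}"

end

theory Submission
  imports Defs "HOL-Number_Theory.Cong" "HOL-Library.Countable"
begin

text \<open>
  The group is a central extension of \<open>V = F\<^sub>p\<^sup>4\<close> by \<open>W = F\<^sub>p\<^sup>3\<close> given by a bilinear cocycle, so that
  commutators are the values of an alternating map \<open>V \<times> V \<rightarrow> W\<close>. The kernel of the induced map
  \<open>\<Lambda>\<^sup>2 V \<rightarrow> W\<close> is chosen as a three-dimensional space on which the Klein quadric has exactly one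
  point, namely \<open>e\<^sub>1 \<and> e\<^sub>2\<close>: it is spanned by this vector and by a copy of the field with \<open>p\<^sup>2\<close> elements
  inside the 2 by 2 matrices, on which the quadratic form is the norm form
  \<open>x\<^sup>2 + x y + n y\<^sup>2\<close>. Let \<open>A\<close> be the preimage of the span of \<open>e\<^sub>1\<close> and \<open>e\<^sub>2\<close>. Then a noncentral
  element of \<open>A\<close> has centralizer \<open>A\<close>, while an element outside \<open>A\<close> has a centralizer of order at
  most \<open>p\<^sup>4\<close>. If a subgroup \<open>U\<close> contains \<open>x \<notin> A\<close> and \<open>C(U)\<close> contains a noncentral \<open>y\<close>, then
  \<open>y \<notin> A\<close>, and \<open>U \<subseteq> C(y)\<close>, \<open>C(U) \<subseteq> C(x)\<close> give \<open>m(U) \<le> p\<^sup>8 < p\<^sup>1\<^sup>0\<close>; in all other cases \<open>C(U)\<close> is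
  the group, \<open>A\<close> or the center.
\<close>

section \<open>Centralizers and a criterion for a three-element Chermak-Delgado lattice\<close>

lemma centralizer_antimono: "U \<subseteq> V \<Longrightarrow> centralizer G V \<subseteq> centralizer G U"
  by (auto simp: centralizer_def)

lemma centralizer_subset_carrier: "centralizer G U \<subseteq> carrier G"
  by (auto simp: centralizer_def)

text \<open>Equality case of the measure bounds: \<open>X\<close> is the chain member that
  \<open>U\<close> should equal, \<open>b\<close> the order of the centralizer of \<open>U\<close>,
  and \<open>c\<close> a bound for it. Both factors are at most their bounds, so attaining the
  positive product leaves no slack in either.\<close>

lemma mult_eq_mult_imp_subset_eq:
  fixes a b :: nat
  assumes "finite X" "U \<subseteq> X" "b \<le> c" "0 < card X * c" "card U * b = card X * c"
  shows "U = X"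
proof -
  have "card U \<le> card X"
    using assms by (simp add: card_mono)
  moreover have "card X * c \<le> card U * c"
    using assms by (metis mult_le_mono2)
  then have "card X \<le> card U"
    using assms by simp
  ultimately have "card U = card X"
    by simp
  then show ?thesis
    using assms card_subset_eq by blast
qed

lemma center_subset_carrier: "center G \<subseteq> carrier G"
  by (auto simp: center_def centralizer_def)

lemma center_closed: "x \<in> center G \<Longrightarrow> x \<in> carrier G"
  using center_subset_carrier by (rule subsetD)

lemma center_commute:
  "\<lbrakk>x \<in> center G; u \<in> carrier G\<rbrakk> \<Longrightarrow> x \<otimes>\<^bsub>G\<^esub> u = u \<otimes>\<^bsub>G\<^esub> x"
  by (auto simp: center_def centralizer_def)

lemma (in group) subgroup_center: "subgroup (center G) G"
proof (rule subgroupI)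
  show "center G \<subseteq> carrier G" by (rule center_subset_carrier)
  show "center G \<noteq> {}" by (auto simp: center_def centralizer_def intro!: exI[of _ \<one>])
next
  fix x assume x: "x \<in> center G"
  then have xc: "x \<in> carrier G" by (rule center_closed)
  have "inv x \<otimes> u = u \<otimes> inv x" if u: "u \<in> carrier G" for u
  proof -
    have "u = x \<otimes> u \<otimes> inv x"
      using center_commute[OF x u] u xc by (metis inv_solve_right m_closed)
    then show ?thesis
      using u xc by (metis inv_closed inv_solve_left m_assoc m_closed)
  qed
  then show "inv x \<in> center G"
    using xc by (simp add: center_def centralizer_def)
next
  fix x y assume x: "x \<in> center G" and y: "y \<in> center G"
  then have xy: "x \<in> carrier G" "y \<in> carrier G" by (simp_all add: center_closed)
  have "x \<otimes> y \<otimes> u = u \<otimes> (x \<otimes> y)" if u: "u \<in> carrier G" for u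
  proof -
    have "x \<otimes> y \<otimes> u = x \<otimes> (u \<otimes> y)"
      using xy u center_commute[OF y u] by (simp add: m_assoc)
    also have "\<dots> = u \<otimes> x \<otimes> y"
      using xy u center_commute[OF x u] by (simp flip: m_assoc)
    finally show ?thesis
      using xy u by (simp add: m_assoc)
  qed
  then show "x \<otimes> y \<in> center G"
    using xy by (simp add: center_def centralizer_def)
qed

text \<open>Reduces the lattice to centralizers of single elements. By \<open>card_A\<close>, all
  three chain members have the same measure. A subgroup is sorted by whether it lies in the center,
  lies in \<open>A\<close> but not in the center, or leaves \<open>A\<close>; in the first two cases
  its centralizer is known exactly.\<close>

lemma (in group) cd_lattice_eq_chain:
  assumes fin: "finite (carrier G)"
    and A: "subgroup A G" and ZA: "center G \<subset> A"
    and card_A: "card A * card A = card (center G) * card (carrier G)"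
    and inside: "\<And>x. x \<in> A - center G \<Longrightarrow> centralizer G {x} = A"
    and outside: "\<And>x. x \<in> carrier G - A \<Longrightarrow>
        card (centralizer G {x}) * card (centralizer G {x}) < card (center G) * card (carrier G)"
  shows "cd_lattice G = {center G, A, carrier G}"
proof -
  let ?Z = "center G" and ?M = "card (center G) * card (carrier G)"
  have Z: "subgroup ?Z G" by (rule subgroup_center)
  have fin_sub: "finite U" if "U \<subseteq> carrier G" for U
    using fin that finite_subset by blast
  have A_sub: "A \<subseteq> carrier G" and Z_sub: "?Z \<subseteq> carrier G"
    using A Z subgroup.subset by auto
  have M_pos: "0 < ?M"
    using fin fin_sub[OF Z_sub] subgroup.one_closed[OF Z] one_closed
    by (auto simp: card_gt_0_iff)
  have fin_C: "finite (centralizer G U)" for U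
    by (rule fin_sub[OF centralizer_subset_carrier])
  have C_in_Z: "centralizer G U = carrier G" if "U \<subseteq> ?Z" for U
    using that Z_sub by (auto simp: center_def centralizer_def)
  have C_in_A: "centralizer G U = A" if UA: "U \<subseteq> A" and UZ: "\<not> U \<subseteq> ?Z" for U
  proof
    obtain x where "x \<in> U" "x \<notin> ?Z" using UZ by auto
    then have "centralizer G {x} = A" using UA inside by auto
    then show "centralizer G U \<subseteq> A"
      using \<open>x \<in> U\<close> centralizer_antimono[of "{x}" U] by auto
    \<comment> \<open>Commutativity of \<open>A\<close> is read off from \<open>inside\<close>: each
      noncentral \<open>u\<close> in \<open>U\<close> has all of \<open>A\<close> as its
      centralizer.\<close>
    show "A \<subseteq> centralizer G U"
    proof
      fix a assume a: "a \<in> A"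
      have "a \<otimes> u = u \<otimes> a" if "u \<in> U" for u
      proof (cases "u \<in> ?Z")
        case True
        then show ?thesis using a A_sub by (auto simp: center_def centralizer_def)
      next
        case False
        then have "centralizer G {u} = A" using that UA inside by auto
        then show ?thesis using a by (auto simp: centralizer_def)
      qed
      then show "a \<in> centralizer G U" using a A_sub by (auto simp: centralizer_def)
    qed
  qed
  have m_Z: "cd_measure G ?Z = ?M"
    by (simp add: cd_measure_def C_in_Z)
  have m_A: "cd_measure G A = ?M"
    using ZA card_A by (simp add: cd_measure_def C_in_A)
  have m_G: "cd_measure G (carrier G) = ?M"
    by (simp add: cd_measure_def center_def)
  have bound: "cd_measure G U \<le> ?M \<and> (cd_measure G U = ?M \<longrightarrow> U \<in> {?Z, A, carrier G})"
    if U: "subgroup U G" for U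
  proof -
    have U_sub: "U \<subseteq> carrier G" using U subgroup.subset by auto
    consider "U \<subseteq> ?Z" | "U \<subseteq> A" "\<not> U \<subseteq> ?Z" | x where "x \<in> U" "x \<notin> A" by auto
    then show ?thesis
    proof cases
      case 1
      have "U = ?Z" if "cd_measure G U = ?M"
        using mult_eq_mult_imp_subset_eq[of ?Z U "card (carrier G)" "card (carrier G)"]
          1 M_pos that fin_sub Z_sub by (simp add: cd_measure_def C_in_Z)
      then show ?thesis
        using 1 fin_sub Z_sub by (simp add: cd_measure_def C_in_Z card_mono)
    next
      case 2
      have "U = A" if "cd_measure G U = ?M"
        using mult_eq_mult_imp_subset_eq[of A U "card A" "card A"]
          2 M_pos that fin_sub A_sub card_A by (simp add: cd_measure_def C_in_A)
      then show ?thesis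
        using 2 fin_sub A_sub card_A[symmetric] by (simp add: cd_measure_def C_in_A card_mono)
    next
      case 3
      show ?thesis
      proof (cases "centralizer G U \<subseteq> ?Z")
        case True
        then have le: "card (centralizer G U) \<le> card ?Z"
          using fin_sub Z_sub by (simp add: card_mono)
        have "U = carrier G" if "cd_measure G U = ?M"
          using mult_eq_mult_imp_subset_eq[of "carrier G" U _ "card ?Z"] le
            fin U_sub M_pos that by (simp add: cd_measure_def mult.commute)
        moreover have "cd_measure G U \<le> ?M"
          using mult_le_mono[OF card_mono[OF fin U_sub] le]
          by (simp add: cd_measure_def mult.commute)
        ultimately show ?thesis by simp
      next
        case False
        then obtain y where y: "y \<in> centralizer G U" "y \<notin> ?Z" by auto
        have yG: "y \<in> carrier G" using y by (simp add: centralizer_def)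
        have x_y: "x \<in> centralizer G {y}"
          using 3 y U_sub by (auto simp: centralizer_def)
        \<comment> \<open>Otherwise the centralizer of the noncentral \<open>y\<close> would be
          \<open>A\<close>, yet it contains \<open>x\<close>.\<close>
        have "y \<notin> A"
          using inside[of y] x_y y 3 by auto
        have xG: "x \<in> carrier G" using 3 U_sub by auto
        let ?cx = "card (centralizer G {x})" and ?cy = "card (centralizer G {y})"
        have "U \<subseteq> centralizer G {y}"
          using y U_sub by (auto simp: centralizer_def)
        then have "card U \<le> ?cy" using fin_C by (simp add: card_mono)
        moreover have "card (centralizer G U) \<le> ?cx"
          using 3 fin_C by (simp add: card_mono centralizer_antimono)
        ultimately have "cd_measure G U \<le> ?cy * ?cx"
          by (simp add: cd_measure_def mult_le_mono)
        \<comment> \<open>The hypothesis \<open>outside\<close> bounds squares only, so the mixed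
          product is replaced by the larger of the two squares.\<close>
        also have "\<dots> \<le> max (?cx * ?cx) (?cy * ?cy)"
          by (cases ?cx ?cy rule: le_cases) (simp_all add: le_max_iff_disj mult_le_mono)
        also have "\<dots> < ?M"
          using outside[of x] outside[of y] 3 xG yG \<open>y \<notin> A\<close> by simp
        finally show ?thesis by simp
      qed
    qed
  qed
  have max: "max_cd_measure G = ?M"
    unfolding max_cd_measure_def
  proof (rule Max_eqI)
    have "{cd_measure G U |U. subgroup U G} \<subseteq> {..?M}" using bound by auto
    then show "finite {cd_measure G U |U. subgroup U G}" using finite_subset by blast
    show "?M \<in> {cd_measure G U |U. subgroup U G}" using Z m_Z[symmetric] by blast
  qed (use bound in auto)
  show ?thesis
  proof
    show "cd_lattice G \<subseteq> {?Z, A, carrier G}"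
      using bound by (simp add: cd_lattice_def max subset_iff)
    show "{?Z, A, carrier G} \<subseteq> cd_lattice G"
      using Z A m_Z m_A m_G subgroup_self by (simp add: cd_lattice_def max)
  qed
qed

section \<open>Elementary abelian centers and quotients\<close>

lemma (in group) elementary_abelian_FactGroup:
  assumes N: "N \<lhd> G"
    and comm: "\<And>x y. \<lbrakk>x \<in> carrier G; y \<in> carrier G\<rbrakk> \<Longrightarrow> \<exists>h\<in>N. x \<otimes> y = h \<otimes> (y \<otimes> x)"
    and pow: "\<And>x. x \<in> carrier G \<Longrightarrow> x [^] p \<in> N"
  shows "elementary_abelian p (G Mod N)"
proof -
  interpret N: normal N G by (rule N)
  interpret Q: group "G Mod N" by (rule N.factorgroup_is_group)
  \<comment> \<open>The factor \<open>h\<close> in \<open>comm\<close> is a commutator written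
    without inverses; the coset of \<open>N\<close> absorbs it.\<close>
  have swap: "N #> (x \<otimes> y) = N #> (y \<otimes> x)" if xy: "x \<in> carrier G" "y \<in> carrier G" for x y
  proof -
    have "x \<otimes> y \<in> N #> (y \<otimes> x)"
      using comm[OF xy] by (auto simp: r_coset_def)
    then show ?thesis
      using repr_independence[OF _ _ N.subgroup_axioms] xy m_closed by simp
  qed
  have "comm_group (G Mod N)"
  proof (rule Q.group_comm_groupI)
    fix X Y assume "X \<in> carrier (G Mod N)" "Y \<in> carrier (G Mod N)"
    then show "X \<otimes>\<^bsub>G Mod N\<^esub> Y = Y \<otimes>\<^bsub>G Mod N\<^esub> X"
      using swap by (auto simp: FactGroup_def RCOSETS_def N.rcos_sum)
  qed
  moreover have "X [^]\<^bsub>G Mod N\<^esub> p = \<one>\<^bsub>G Mod N\<^esub>" if X: "X \<in> carrier (G Mod N)" for X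
  proof -
    obtain x where "x \<in> carrier G" "X = N #> x"
      using X by (auto simp: FactGroup_def RCOSETS_def)
    then show ?thesis
      using N.FactGroup_pow[of x p] pow[of x] coset_join2[OF _ N.subgroup_axioms, of "x [^] p"]
      by (simp add: FactGroup_def)
  qed
  ultimately show ?thesis by (simp add: elementary_abelian_def)
qed

lemma (in group) elementary_abelian_center:
  assumes pow: "\<And>x. x \<in> center G \<Longrightarrow> x [^] p = \<one>"
  shows "elementary_abelian p (G\<lparr>carrier := center G\<rparr>)"
proof -
  interpret Z: group "G\<lparr>carrier := center G\<rparr>"
    using subgroup_center subgroup_imp_group by blast
  have "comm_group (G\<lparr>carrier := center G\<rparr>)"
    by (rule Z.group_comm_groupI) (simp add: center_closed center_commute)
  then show ?thesis
    using pow by (simp add: elementary_abelian_def nat_pow_consistent[symmetric])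
qed

lemma (in group) center_normal: "center G \<lhd> G"
proof -
  have "x \<otimes> h \<otimes> inv x = h" if "x \<in> carrier G" "h \<in> center G" for x h
  proof -
    have "h \<otimes> x = x \<otimes> h" "h \<in> carrier G"
      using that by (auto intro: center_closed center_commute)
    then show ?thesis
      using that by (metis inv_solve_right' m_closed)
  qed
  then show ?thesis
    by (auto simp: normal_inv_iff subgroup_center)
qed

section \<open>A binary quadratic form without nontrivial zeros modulo a prime\<close>

lemma exists_irreducible_quadratic:
  fixes p :: int
  assumes "prime p"
  shows "\<exists>n. \<forall>x. \<not> p dvd x * x + x + n"
proof -
  have p: "1 < p" using assms by (rule prime_gt_1_int)
  let ?f = "\<lambda>x. (x * x + x) mod p"
  \<comment> \<open>The residues 0 and -1 collide under x^2 + x, so this map of a finite set to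
    itself misses some residue \<open>m\<close>, and n = -m works. The linear term keeps the
    argument valid for p = 2, where squaring alone is a bijection.\<close>
  have "(p - 1) * (p - 1) + (p - 1) = (p - 1) * p"
    by (simp add: algebra_simps)
  then have "?f 0 = ?f (p - 1)"
    by simp
  then have "\<not> inj_on ?f {0..<p}"
    using p inj_onD[of ?f "{0..<p}" 0 "p - 1"] by fastforce
  moreover have "?f ` {0..<p} \<subseteq> {0..<p}" using p by auto
  ultimately have "?f ` {0..<p} \<noteq> {0..<p}"
    using eq_card_imp_inj_on[of "{0..<p}" ?f] by auto
  then obtain m where m: "m \<in> {0..<p}" "m \<notin> ?f ` {0..<p}"
    using \<open>?f ` {0..<p} \<subseteq> {0..<p}\<close> by blast
  have "\<not> p dvd x * x + x + (- m)" for x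
  proof
    assume "p dvd x * x + x + (- m)"
    then have "(x * x + x) mod p = m mod p"
      by (simp add: mod_eq_dvd_iff)
    moreover have "[x mod p * (x mod p) + x mod p = x * x + x] (mod p)"
      by (intro cong_add cong_mult) (simp_all add: cong_def)
    ultimately have "?f (x mod p) = m"
      using m by (simp add: cong_def)
    then show False
      using m(2) p image_eqI[of m ?f "x mod p" "{0..<p}"] by simp
  qed
  then show ?thesis by blast
qed

text \<open>If \<open>b\<close> were invertible modulo \<open>p\<close> with inverse
  \<open>u\<close>, scaling the form by u^2 would make a * u a root of x^2 + x + n. Hence
  \<open>p\<close> divides \<open>b\<close>, and then a^2.\<close>

lemma anisotropic_binary_form:
  fixes p :: int
  assumes p: "prime p" and n: "\<And>x. \<not> p dvd x * x + x + n"
    and dvd: "p dvd a * a + a * b + n * b * b"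
  shows "p dvd a \<and> p dvd b"
proof -
  have b: "p dvd b"
  proof (rule ccontr)
    assume "\<not> p dvd b"
    then have "coprime b p" using p by (metis prime_imp_coprime coprime_commute)
    then obtain u where "[b * u = 1] (mod p)" using cong_solve_coprime_int by blast
    then have "[a * u * (a * u) + a * u * (b * u) + n * (b * u) * (b * u)
        = a * u * (a * u) + a * u * 1 + n * 1 * 1] (mod p)"
      by (intro cong_add cong_mult cong_refl)
    moreover have "p dvd a * u * (a * u) + a * u * (b * u) + n * (b * u) * (b * u)"
      using dvd_mult2[OF dvd, of "u * u"] by (simp add: algebra_simps)
    ultimately show False using n[of "a * u"] by (simp add: cong_dvd_iff)
  qed
  then have "p dvd a * a"
    using dvd by (metis dvd_add_left_iff dvd_mult dvd_mult2 dvd_triv_right add.assoc)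
  then show ?thesis using b p by (auto simp: prime_dvd_mult_iff)
qed


section \<open>The bilinear cocycle and its product on septuples\<close>

type_synonym septuple = "int \<times> int \<times> int \<times> int \<times> int \<times> int \<times> int"

text \<open>Group elements are stored as numbers because the group is to be a
  \<open>nat monoid\<close>; computations take place on the decoded tuples.\<close>

abbreviation code :: "septuple \<Rightarrow> nat" where "code \<equiv> to_nat"

locale anisotropic_cocycle =
  fixes p :: nat and n :: int
  assumes prime_p: "Factorial_Ring.prime p"
    and irreducible: "\<not> int p dvd x * x + x + n"
begin

text \<open>The two expressions form a linear system in \<open>c\<close> and \<open>d\<close> whose
  determinant is the anisotropic form \<open>?q\<close> in \<open>a\<close> and \<open>b\<close>.
  The two identities in the proof are Cramer's rule.\<close>

lemma anisotropic_dichotomy: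
  assumes "int p dvd a * d + n * b * c" "int p dvd b * d - a * c - b * c"
  shows "(int p dvd a \<and> int p dvd b) \<or> (int p dvd c \<and> int p dvd d)"
proof (rule disjCI)
  assume cd: "\<not> (int p dvd c \<and> int p dvd d)"
  let ?q = "a * a + a * b + n * b * b"
  have "?q * c = b * (a * d + n * b * c) - a * (b * d - a * c - b * c)"
    and "?q * d = (a + b) * (a * d + n * b * c) + n * b * (b * d - a * c - b * c)"
    by (simp_all add: algebra_simps)
  then have "int p dvd ?q * c" "int p dvd ?q * d"
    using assms by (simp_all add: dvd_add dvd_diff)
  then have "int p dvd ?q"
    using cd prime_p by (auto simp: prime_dvd_mult_iff)
  then show "int p dvd a \<and> int p dvd b"
    using anisotropic_binary_form[of "int p" n a b] prime_p irreducible by simp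
qed

abbreviation F :: "int set" where "F \<equiv> {0..<int p}"

fun reduce :: "septuple \<Rightarrow> septuple" where
  "reduce (a, b, c, d, x, y, z) = (a mod int p, b mod int p, c mod int p, d mod int p,
     x mod int p, y mod int p, z mod int p)"

text \<open>The coordinates a, b, c, d belong to \<open>V\<close> and x, y, z to \<open>W\<close>.
  No cocycle term pairs (a, b) with (a', b'), so the plane c = d = 0 is isotropic for the commutator
  map. When the left factor lies over this plane, the second and third terms are the system of
  \<open>anisotropic_dichotomy\<close>.\<close>

fun int_mult :: "septuple \<Rightarrow> septuple \<Rightarrow> septuple" where
  "int_mult (a, b, c, d, x, y, z) (a', b', c', d', x', y', z') =
     (a + a', b + b', c + c', d + d',
      x + x' + c * d', y + y' + a * d' + n * b * c', z + z' + b * d' - a * c' - b * c')"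

definition cocycle_mult :: "septuple \<Rightarrow> septuple \<Rightarrow> septuple" where
  "cocycle_mult s t = reduce (int_mult s t)"

lemma cocycle_mult_simps [simp]:
  "cocycle_mult (a, b, c, d, x, y, z) (a', b', c', d', x', y', z') =
     ((a + a') mod int p, (b + b') mod int p, (c + c') mod int p, (d + d') mod int p,
      (x + x' + c * d') mod int p, (y + y' + a * d' + n * b * c') mod int p,
      (z + z' + b * d' - a * c' - b * c') mod int p)"
  by (simp add: cocycle_mult_def)

text \<open>Products are integer polynomials in the coordinates, so reduction can be postponed.
  Associativity and the other identities of \<open>cocycle_mult\<close> then follow from integer
  identities for \<open>int_mult\<close>.\<close>

lemma cocycle_mult_reduce_left: "cocycle_mult (reduce s) t = reduce (int_mult s t)"
  by (cases s; cases t)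
    (auto simp flip: cong_def intro!: cong_add cong_diff cong_mult; simp add: cong_def)

lemma cocycle_mult_reduce_right: "cocycle_mult s (reduce t) = reduce (int_mult s t)"
  by (cases s; cases t)
    (auto simp flip: cong_def intro!: cong_add cong_diff cong_mult; simp add: cong_def)

lemma cocycle_mult_reduce_both: "cocycle_mult (reduce s) (reduce t) = reduce (int_mult s t)"
  by (metis cocycle_mult_def cocycle_mult_reduce_left cocycle_mult_reduce_right)

lemma int_mult_assoc: "int_mult (int_mult r s) t = int_mult r (int_mult s t)"
  by (cases r; cases s; cases t) (simp add: algebra_simps)

lemma cocycle_mult_assoc:
  "cocycle_mult (cocycle_mult r s) t = cocycle_mult r (cocycle_mult s t)"
  by (simp only: cocycle_mult_def [of r s] cocycle_mult_def [of s t]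
      cocycle_mult_reduce_left cocycle_mult_reduce_right int_mult_assoc)

section \<open>The group on the encoded septuples\<close>

definition cocycle_group :: "nat monoid" where
  "cocycle_group =
     \<lparr>carrier = code ` (F \<times> F \<times> F \<times> F \<times> F \<times> F \<times> F),
      monoid.mult = (\<lambda>u v. code (cocycle_mult (from_nat u) (from_nat v))),
      monoid.one = code (0, 0, 0, 0, 0, 0, 0)\<rparr>"

text \<open>The middle term \<open>A\<close> of the chain: the preimage of the plane in
  \<open>V\<close> on which the commutator map vanishes.\<close>

definition isotropic :: "nat set" where
  "isotropic = code ` (F \<times> F \<times> {0} \<times> {0} \<times> F \<times> F \<times> F)"

lemma p_pos: "0 < int p"
  using prime_p by (simp add: prime_gt_0_nat)

lemma mem_carrier [simp]:
  "code (a, b, c, d, x, y, z) \<in> carrier cocycle_group \<longleftrightarrow>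
     a \<in> F \<and> b \<in> F \<and> c \<in> F \<and> d \<in> F \<and> x \<in> F \<and> y \<in> F \<and> z \<in> F"
  by (auto simp: cocycle_group_def image_iff)

lemma mem_isotropic [simp]:
  "code (a, b, c, d, x, y, z) \<in> isotropic \<longleftrightarrow>
     a \<in> F \<and> b \<in> F \<and> c = 0 \<and> d = 0 \<and> x \<in> F \<and> y \<in> F \<and> z \<in> F"
  by (auto simp: isotropic_def image_iff)

lemma carrierE:
  assumes "u \<in> carrier cocycle_group"
  obtains a b c d x y z where "u = code (a, b, c, d, x, y, z)"
    "a \<in> F" "b \<in> F" "c \<in> F" "d \<in> F" "x \<in> F" "y \<in> F" "z \<in> F"
  using assms by (auto simp: cocycle_group_def)

lemma mult_code [simp]:
  "code s \<otimes>\<^bsub>cocycle_group\<^esub> code t = code (cocycle_mult s t)"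
  by (simp add: cocycle_group_def)

lemma one_eq: "\<one>\<^bsub>cocycle_group\<^esub> = code (0, 0, 0, 0, 0, 0, 0)"
  by (simp add: cocycle_group_def)

lemma F_dvd_diff: "\<lbrakk>a \<in> F; b \<in> F; int p dvd a - b\<rbrakk> \<Longrightarrow> a = b"
  by (metis atLeastLessThan_iff mod_eq_dvd_iff mod_pos_pos_trivial)

lemma F_dvd: "a \<in> F \<Longrightarrow> int p dvd a \<longleftrightarrow> a = 0"
  using F_dvd_diff[of a 0] p_pos by auto

lemma group_cocycle_group: "group cocycle_group"
proof (rule groupI)
  fix u v assume "u \<in> carrier cocycle_group" "v \<in> carrier cocycle_group"
  then show "u \<otimes>\<^bsub>cocycle_group\<^esub> v \<in> carrier cocycle_group"
    using p_pos by (elim carrierE) simp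
next
  show "\<one>\<^bsub>cocycle_group\<^esub> \<in> carrier cocycle_group"
    using p_pos by (simp add: one_eq)
next
  fix u v w
  assume "u \<in> carrier cocycle_group" "v \<in> carrier cocycle_group" "w \<in> carrier cocycle_group"
  then show "u \<otimes>\<^bsub>cocycle_group\<^esub> v \<otimes>\<^bsub>cocycle_group\<^esub> w
      = u \<otimes>\<^bsub>cocycle_group\<^esub> (v \<otimes>\<^bsub>cocycle_group\<^esub> w)"
    by (elim carrierE) (simp only: mult_code cocycle_mult_assoc)
next
  fix u assume "u \<in> carrier cocycle_group"
  then show "\<one>\<^bsub>cocycle_group\<^esub> \<otimes>\<^bsub>cocycle_group\<^esub> u = u"
    by (elim carrierE) (simp add: one_eq)
next
  fix u assume "u \<in> carrier cocycle_group"
  then obtain a b c d x y z where u: "u = code (a, b, c, d, x, y, z)"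
    by (elim carrierE) blast
  \<comment> \<open>With B the cocycle, B(-v, v) = -B(v, v). So the last three coordinates of the
    inverse are negated and corrected by B(v, v).\<close>
  let ?r = "(- a, - b, - c, - d, - x + c * d, - y + a * d + n * b * c, - z + b * d - a * c - b * c)"
  have "int_mult ?r (a, b, c, d, x, y, z) = (0, 0, 0, 0, 0, 0, 0)"
    by (simp add: algebra_simps)
  then have "code (reduce ?r) \<otimes>\<^bsub>cocycle_group\<^esub> u = \<one>\<^bsub>cocycle_group\<^esub>"
    by (simp add: u one_eq cocycle_mult_reduce_left del: int_mult.simps reduce.simps) simp
  moreover have "code (reduce ?r) \<in> carrier cocycle_group"
    using p_pos by simp
  ultimately show "\<exists>v\<in>carrier cocycle_group. v \<otimes>\<^bsub>cocycle_group\<^esub> u = \<one>\<^bsub>cocycle_group\<^esub>"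
    by blast
qed

sublocale group cocycle_group
  by (rule group_cocycle_group)

section \<open>Commutation, the center and the orders\<close>

lemma commute_iff:
  "cocycle_mult (a, b, c, d, x, y, z) (a', b', c', d', x', y', z')
     = cocycle_mult (a', b', c', d', x', y', z') (a, b, c, d, x, y, z) \<longleftrightarrow>
   int p dvd c * d' - c' * d \<and>
   int p dvd (a * d' + n * b * c') - (a' * d + n * b' * c) \<and>
   int p dvd (b * d' - a * c' - b * c') - (b' * d - a' * c - b' * c)"
  \<comment> \<open>The additive parts agree on both sides; what remains is the antisymmetrised
    cocycle, one condition per coordinate of \<open>W\<close>.\<close>
  by (simp add: mod_eq_dvd_iff algebra_simps)

lemma mem_centralizer_iff [simp]:
  "code s \<in> centralizer cocycle_group {code t} \<longleftrightarrow>
     code s \<in> carrier cocycle_group \<and> cocycle_mult s t = cocycle_mult t s"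
  by (simp add: centralizer_def)

lemma center_eq:
  "center cocycle_group = code ` ({0} \<times> {0} \<times> {0} \<times> {0} \<times> F \<times> F \<times> F)"
proof (intro equalityI subsetI)
  fix u assume u: "u \<in> center cocycle_group"
  then have "u \<in> carrier cocycle_group"
    by (simp add: center_def centralizer_def)
  then obtain a b c d x y z where eq: "u = code (a, b, c, d, x, y, z)"
    and F: "a \<in> F" "b \<in> F" "c \<in> F" "d \<in> F" "x \<in> F" "y \<in> F" "z \<in> F"
    by (elim carrierE)
  have "1 < p" using prime_p by (rule prime_gt_1_nat)
  have "u \<otimes>\<^bsub>cocycle_group\<^esub> v = v \<otimes>\<^bsub>cocycle_group\<^esub> u" if "v \<in> carrier cocycle_group" for v
    using u that by (auto simp: center_def centralizer_def)
  \<comment> \<open>Commuting with the fourth basis vector of \<open>V\<close> kills a, b and c;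
    commuting with the third kills d.\<close>
  from this[of "code (0, 0, 1, 0, 0, 0, 0)"] this[of "code (0, 0, 0, 1, 0, 0, 0)"]
  have "int p dvd a" "int p dvd b" "int p dvd c" "int p dvd d"
    using \<open>1 < p\<close> by (auto simp: eq commute_iff simp del: cocycle_mult_simps)
  then show "u \<in> code ` ({0} \<times> {0} \<times> {0} \<times> {0} \<times> F \<times> F \<times> F)"
    using F by (auto simp: eq F_dvd)
next
  fix u assume "u \<in> code ` ({0} \<times> {0} \<times> {0} \<times> {0} \<times> F \<times> F \<times> F)"
  then obtain x y z where u: "u = code (0, 0, 0, 0, x, y, z)"
    and F: "x \<in> F" "y \<in> F" "z \<in> F"
    by auto
  have "u \<otimes>\<^bsub>cocycle_group\<^esub> v = v \<otimes>\<^bsub>cocycle_group\<^esub> u" if "v \<in> carrier cocycle_group" for v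
    using that by (elim carrierE) (simp add: u add.commute)
  then show "u \<in> center cocycle_group"
    using F p_pos by (simp add: center_def centralizer_def u)
qed

lemma mem_center [simp]:
  "code (a, b, c, d, x, y, z) \<in> center cocycle_group \<longleftrightarrow>
     a = 0 \<and> b = 0 \<and> c = 0 \<and> d = 0 \<and> x \<in> F \<and> y \<in> F \<and> z \<in> F"
  by (auto simp: center_eq image_iff)

lemma card_carrier: "card (carrier cocycle_group) = p ^ 7"
  by (simp add: cocycle_group_def card_image card_cartesian_product eval_nat_numeral)

lemma card_center: "card (center cocycle_group) = p ^ 3"
  by (simp add: center_eq card_image card_cartesian_product eval_nat_numeral)

lemma card_isotropic: "card isotropic = p ^ 5"
  by (simp add: isotropic_def card_image card_cartesian_product eval_nat_numeral)

lemma finite_carrier: "finite (carrier cocycle_group)"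
  by (simp add: cocycle_group_def)

section \<open>The isotropic subgroup and the centralizers of single elements\<close>

lemma isotropicE:
  assumes "u \<in> isotropic"
  obtains a b x y z where "u = code (a, b, 0, 0, x, y, z)"
    "a \<in> F" "b \<in> F" "x \<in> F" "y \<in> F" "z \<in> F"
  using assms by (auto simp: isotropic_def)

lemma isotropic_subset: "isotropic \<subseteq> carrier cocycle_group"
  using p_pos by (auto elim!: isotropicE)

text \<open>With c = d = 0 in \<open>u\<close> the first commutator coordinate vanishes. The other
  two are the system of \<open>anisotropic_dichotomy\<close> for (a, b) and (c', d'); since (a, b)
  is nonzero, (c', d') must be zero.\<close>

lemma centralizer_isotropic:
  assumes "u \<in> isotropic - center cocycle_group"
  shows "centralizer cocycle_group {u} = isotropic"
proof -
  from assms obtain a b x y z where u: "u = code (a, b, 0, 0, x, y, z)"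
    and F: "a \<in> F" "b \<in> F" "x \<in> F" "y \<in> F" "z \<in> F"
    by (auto elim: isotropicE)
  have ab: "\<not> (int p dvd a \<and> int p dvd b)"
    using assms F by (auto simp: u F_dvd)
  show ?thesis
  proof (intro equalityI subsetI)
    fix v assume v: "v \<in> centralizer cocycle_group {u}"
    then have "v \<in> carrier cocycle_group" by (simp add: centralizer_def)
    then obtain a' b' c' d' x' y' z' where eq: "v = code (a', b', c', d', x', y', z')"
      and F': "a' \<in> F" "b' \<in> F" "c' \<in> F" "d' \<in> F" "x' \<in> F" "y' \<in> F" "z' \<in> F"
      by (elim carrierE)
    have "cocycle_mult (a, b, 0, 0, x, y, z) (a', b', c', d', x', y', z')
        = cocycle_mult (a', b', c', d', x', y', z') (a, b, 0, 0, x, y, z)"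
      using v by (simp add: eq u del: cocycle_mult_simps)
    then have "int p dvd c' \<and> int p dvd d'"
      using anisotropic_dichotomy[of a d' b c'] ab
      by (simp add: commute_iff del: cocycle_mult_simps)
    then show "v \<in> isotropic" using F' by (auto simp: eq F_dvd)
  next
    fix v assume "v \<in> isotropic"
    then show "v \<in> centralizer cocycle_group {u}"
      using isotropic_subset
      by (auto elim!: isotropicE simp: u commute_iff simp del: cocycle_mult_simps)
  qed
qed

lemma isotropic_subgroup: "subgroup isotropic cocycle_group"
proof (rule subgroupI)
  show "isotropic \<subseteq> carrier cocycle_group" by (rule isotropic_subset)
  show "isotropic \<noteq> {}" using p_pos by (auto simp: isotropic_def)
next
  fix u assume u: "u \<in> isotropic"
  then have "u \<in> carrier cocycle_group" using isotropic_subset by auto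
  then have "inv\<^bsub>cocycle_group\<^esub> u \<in> carrier cocycle_group"
    "inv\<^bsub>cocycle_group\<^esub> u \<otimes>\<^bsub>cocycle_group\<^esub> u = \<one>\<^bsub>cocycle_group\<^esub>"
    by simp_all
  \<comment> \<open>The first four coordinates add under multiplication, so those of the inverse in
    the c and d places are residues congruent to 0.\<close>
  then show "inv\<^bsub>cocycle_group\<^esub> u \<in> isotropic"
    using u by (elim isotropicE carrierE) (simp add: one_eq)
next
  fix u v assume "u \<in> isotropic" "v \<in> isotropic"
  then show "u \<otimes>\<^bsub>cocycle_group\<^esub> v \<in> isotropic"
    using p_pos by (auto elim!: isotropicE)
qed

text \<open>The first commutator condition makes (c', d') proportional to the nonzero (c, d),
  leaving at most \<open>p\<close> choices. Each choice admits at most one (a', b') by the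
  dichotomy, and the central coordinates contribute p^3.\<close>

lemma card_centralizer_outside:
  assumes "u \<in> carrier cocycle_group - isotropic"
  shows "card (centralizer cocycle_group {u}) \<le> p ^ 4"
proof -
  from assms obtain a b c d x y z where u: "u = code (a, b, c, d, x, y, z)"
    and F: "a \<in> F" "b \<in> F" "c \<in> F" "d \<in> F" "x \<in> F" "y \<in> F" "z \<in> F"
    by (auto elim: carrierE)
  have cd: "\<not> (int p dvd c \<and> int p dvd d)"
    using assms F by (auto simp: u F_dvd)
  let ?C = "centralizer cocycle_group {u}"
  \<comment> \<open>Keeps the coordinate of (c', d') that determines the other, together with the
    central ones. If c is nonzero, c' determines d'; if c is zero, then d is not, so c' is zero and
    d' is kept.\<close>
  define g where "g = (\<lambda>(a, b, c', d', xyz).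
    (if int p dvd c then d' else c', xyz)) \<circ> (from_nat :: nat \<Rightarrow> septuple)"
  have "inj_on g ?C"
  proof (rule inj_onI)
    fix v w assume v: "v \<in> ?C" and w: "w \<in> ?C" and g: "g v = g w"
    have "v \<in> carrier cocycle_group" using v by (simp add: centralizer_def)
    then obtain a1 b1 c1 d1 x1 y1 z1 where v_eq: "v = code (a1, b1, c1, d1, x1, y1, z1)"
      and F1: "a1 \<in> F" "b1 \<in> F" "c1 \<in> F" "d1 \<in> F"
      by (elim carrierE) blast
    have "w \<in> carrier cocycle_group" using w by (simp add: centralizer_def)
    then obtain a2 b2 c2 d2 x2 y2 z2 where w_eq: "w = code (a2, b2, c2, d2, x2, y2, z2)"
      and F2: "a2 \<in> F" "b2 \<in> F" "c2 \<in> F" "d2 \<in> F"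
      by (elim carrierE) blast
    have v': "int p dvd c1 * d - c * d1"
      "int p dvd (a1 * d + n * b1 * c) - (a * d1 + n * b * c1)"
      "int p dvd (b1 * d - a1 * c - b1 * c) - (b * d1 - a * c1 - b * c1)"
      using v by (simp_all add: v_eq u commute_iff del: cocycle_mult_simps)
    have w': "int p dvd c2 * d - c * d2"
      "int p dvd (a2 * d + n * b2 * c) - (a * d2 + n * b * c2)"
      "int p dvd (b2 * d - a2 * c - b2 * c) - (b * d2 - a * c2 - b * c2)"
      using w by (simp_all add: w_eq u commute_iff del: cocycle_mult_simps)
    \<comment> \<open>The conditions for commuting with \<open>u\<close> are linear in the other
      element, so those for \<open>v\<close> and \<open>w\<close> can be subtracted.\<close>
    have "int p dvd (c1 - c2) * d - c * (d1 - d2)"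
      using dvd_diff[OF v'(1) w'(1)] by (simp add: algebra_simps)
    then have "int p dvd c1 - c2 \<and> int p dvd d1 - d2"
      using g cd prime_p
      by (auto simp: g_def v_eq w_eq prime_dvd_mult_iff split: if_splits)
    then have [simp]: "c1 = c2" "d1 = d2"
      using F1 F2 F_dvd_diff by blast+
    \<comment> \<open>Once the c and d coordinates agree, the two remaining conditions are the
      dichotomy system for the differences against the nonzero (c, d).\<close>
    have "int p dvd (a1 - a2) * d + n * (b1 - b2) * c"
      using dvd_diff[OF v'(2) w'(2)] by (simp add: algebra_simps)
    moreover have "int p dvd (b1 - b2) * d - (a1 - a2) * c - (b1 - b2) * c"
      using dvd_diff[OF v'(3) w'(3)] by (simp add: algebra_simps)
    ultimately have "int p dvd a1 - a2 \<and> int p dvd b1 - b2"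
      using anisotropic_dichotomy cd by blast
    then have "a1 = a2" "b1 = b2"
      using F1 F2 F_dvd_diff by blast+
    then show "v = w" using g by (simp add: v_eq w_eq g_def)
  qed
  moreover have "g ` ?C \<subseteq> F \<times> F \<times> F \<times> F"
  proof
    fix t assume "t \<in> g ` ?C"
    then obtain v where "v \<in> carrier cocycle_group" "t = g v"
      by (auto simp: centralizer_def)
    then show "t \<in> F \<times> F \<times> F \<times> F"
      by (elim carrierE) (simp add: g_def)
  qed
  ultimately have "card ?C \<le> card (F \<times> F \<times> F \<times> F)"
    by (rule card_inj_on_le) simp
  then show ?thesis
    by (simp add: card_cartesian_product eval_nat_numeral)
qed

section \<open>Powers, and the two elementary abelian sections\<close>

lemma pow_coords:
  "\<exists>x' y' z'. code (a, b, c, d, x, y, z) [^]\<^bsub>cocycle_group\<^esub> (k :: nat)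
     = code (int k * a mod int p, int k * b mod int p, int k * c mod int p,
               int k * d mod int p, x', y', z')"
proof (induction k)
  case 0
  then show ?case by (auto simp: one_eq)
next
  case (Suc k)
  then show ?case by (auto simp: mod_simps algebra_simps)
qed

lemma pow_center:
  "code (0, 0, 0, 0, x, y, z) [^]\<^bsub>cocycle_group\<^esub> (k :: nat)
     = code (0, 0, 0, 0,
               int k * x mod int p, int k * y mod int p, int k * z mod int p)"
  by (induction k) (simp_all add: one_eq mod_simps algebra_simps)

lemma elementary_abelian_center_cocycle_group:
  "elementary_abelian p (cocycle_group\<lparr>carrier := center cocycle_group\<rparr>)"
proof (rule elementary_abelian_center)
  fix u assume "u \<in> center cocycle_group"
  then obtain x y z where "u = code (0, 0, 0, 0, x, y, z)"
    by (auto simp: center_eq)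
  then show "u [^]\<^bsub>cocycle_group\<^esub> p = \<one>\<^bsub>cocycle_group\<^esub>"
    by (simp add: pow_center one_eq)
qed

lemma elementary_abelian_mod_center:
  "elementary_abelian p (cocycle_group Mod center cocycle_group)"
proof (rule elementary_abelian_FactGroup[OF center_normal])
  fix u assume u: "u \<in> carrier cocycle_group"
  then obtain a b c d x y z where u_eq: "u = code (a, b, c, d, x, y, z)"
    by (elim carrierE) blast
  \<comment> \<open>The last three coordinates collect cocycle terms and stay unspecified: the
    vanishing of the first four already makes the power central.\<close>
  obtain x' y' z' where eq: "u [^]\<^bsub>cocycle_group\<^esub> p
      = code (0, 0, 0, 0, x', y', z')"
    using pow_coords[of a b c d x y z p] by (auto simp: u_eq)
  then have "code (0, 0, 0, 0, x', y', z') \<in> carrier cocycle_group"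
    using nat_pow_closed[OF u, of p] by simp
  then show "u [^]\<^bsub>cocycle_group\<^esub> p \<in> center cocycle_group"
    unfolding eq by simp
next
  fix u v assume "u \<in> carrier cocycle_group" "v \<in> carrier cocycle_group"
  then obtain a b c d x y z a' b' c' d' x' y' z'
    where eq: "u = code (a, b, c, d, x, y, z)" "v = code (a', b', c', d', x', y', z')"
    by (elim carrierE)
  \<comment> \<open>The value of the commutator map as a central element. Its coordinates in
    \<open>V\<close> are zero, so multiplying by it merely adds it in \<open>W\<close> and turns one
    product into the other.\<close>
  let ?r = "(0, 0, 0, 0, c * d' - c' * d, (a * d' + n * b * c') - (a' * d + n * b' * c),
    (b * d' - a * c' - b * c') - (b' * d - a' * c - b' * c))"
  have "int_mult (a, b, c, d, x, y, z) (a', b', c', d', x', y', z')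
      = int_mult ?r (int_mult (a', b', c', d', x', y', z') (a, b, c, d, x, y, z))"
    by (simp add: algebra_simps)
  then have "u \<otimes>\<^bsub>cocycle_group\<^esub> v
      = code (reduce ?r) \<otimes>\<^bsub>cocycle_group\<^esub> (v \<otimes>\<^bsub>cocycle_group\<^esub> u)"
    by (simp only: eq mult_code cocycle_mult_def [of "(a, b, c, d, x, y, z)"]
        cocycle_mult_def [of "(a', b', c', d', x', y', z')"] cocycle_mult_reduce_both)
  moreover have "code (reduce ?r) \<in> center cocycle_group"
    using p_pos by simp
  ultimately show "\<exists>h\<in>center cocycle_group. u \<otimes>\<^bsub>cocycle_group\<^esub> v
      = h \<otimes>\<^bsub>cocycle_group\<^esub> (v \<otimes>\<^bsub>cocycle_group\<^esub> u)"
    by blast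
qed

section \<open>The Chermak-Delgado chain of the cocycle group\<close>

lemma center_psubset_isotropic: "center cocycle_group \<subset> isotropic"
proof -
  have "1 < p" using prime_p by (rule prime_gt_1_nat)
  then have "card (center cocycle_group) < card isotropic"
    by (simp add: card_center card_isotropic)
  moreover have "center cocycle_group \<subseteq> isotropic"
    using p_pos by (auto simp: center_eq)
  ultimately show ?thesis by auto
qed

lemma isotropic_psubset_carrier: "isotropic \<subset> carrier cocycle_group"
proof -
  have "1 < p" using prime_p by (rule prime_gt_1_nat)
  then have "card isotropic < card (carrier cocycle_group)"
    by (simp add: card_carrier card_isotropic)
  then show ?thesis using isotropic_subset by auto
qed

lemma cd_lattice_cocycle_group:
  "cd_lattice cocycle_group = {center cocycle_group, isotropic, carrier cocycle_group}"
proof (rule cd_lattice_eq_chain[OF finite_carrier isotropic_subgroup center_psubset_isotropic])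
  show "card isotropic * card isotropic
      = card (center cocycle_group) * card (carrier cocycle_group)"
    by (simp add: card_isotropic card_center card_carrier flip: power_add)
next
  fix u assume "u \<in> carrier cocycle_group - isotropic"
  then have "card (centralizer cocycle_group {u}) * card (centralizer cocycle_group {u})
      \<le> p ^ 4 * p ^ 4"
    by (intro mult_le_mono card_centralizer_outside)
  also have "\<dots> < p ^ 10"
    using prime_gt_1_nat[OF prime_p] by (simp flip: power_add)
  also have "\<dots> = card (center cocycle_group) * card (carrier cocycle_group)"
    by (simp add: card_center card_carrier flip: power_add)
  finally show "card (centralizer cocycle_group {u}) * card (centralizer cocycle_group {u})
      < card (center cocycle_group) * card (carrier cocycle_group)" .
qed (rule centralizer_isotropic)

end

theorem proposition2p6:
  fixes p :: nat
  assumes "Factorial_Ring.prime p"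
  shows "\<exists>P :: nat monoid.
           group P \<and> order P = p ^ 7 \<and>
           elementary_abelian p (P\<lparr>carrier := center P\<rparr>) \<and>
           elementary_abelian p (P Mod center P) \<and>
           (\<exists>A. subgroup A P \<and> center P \<subset> A \<and> A \<subset> carrier P \<and>
                cd_lattice P = {center P, A, carrier P})"
proof -
  obtain n where "\<And>x. \<not> int p dvd x * x + x + n"
    using exists_irreducible_quadratic[of "int p"] assms by auto
  then interpret anisotropic_cocycle p n
    using assms by unfold_locales auto
  show ?thesis
    using group_cocycle_group card_carrier elementary_abelian_center_cocycle_group
      elementary_abelian_mod_center isotropic_subgroup center_psubset_isotropic
      isotropic_psubset_carrier cd_lattice_cocycle_group
    by (intro exI[of _ cocycle_group] conjI exI[of _ isotropic]) (auto simp: order_def)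
qed

end
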